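(* Let $(X,\{R_i\}_{i=0}^n)$ be a $Q$-bipartite $Q$-polynomial association scheme with multiplicities $m_0,\ldots,m_n$, dual eigenvalues $\theta_0^*,\ldots,\theta_n^*$ and associated polynomials $v_0^*,\ldots,v_n^*$, and let $C\subseteq X$ be a non-empty symmetric inner distribution code with degree $s$. Then: (i) $$|C|\leq \sum_{\substack{0 \leq i \leq s\\ i\equiv s \pmod 2}}m_i.$$ (ii) Let $\Psi^*_s(x) := \sum_{0 \leq i \leq s,\ i\equiv s \pmod 2} v_i^*(x)$. If equality holds in (i), then the zeros of $\Psi_s^*(x)$ are distinct dual eigenvalues $\theta_i^*$, $i \in S$, for some $s$-subset $S \subseteq \{1,\ldots,n-1\}$.
   Context: Let $X$ be a finite set, $R_0,\ldots,R_n$ non-empty subsets of $X\times X$, and $A_i$ the adjacency matrix of $R_i$. The pair $(X,\{R_i\}_{i=0}^n)$ is a symmetric association scheme of class $n$ if $A_0=I$, $\sum_i A_i=J$ (the all-ones matrix), $A_i^\top=A_i$ for all $i$, and each $A_iA_j$ is a linear combination of $A_0,\ldots,A_n$. The real span of the $A_i$ is a commutative semisimple algebra with primitive idempotents $E_0=\frac1{|X|}J,E_1,\ldots,E_n$ (in a fixed ordering). The second eigenmatrix $Q$ is defined by $E_i=\frac{1}{|X|}\sum_{j=0}^n Q_{ji}A_j$, the multiplicity is $m_i=Q_{0i}=\operatorname{rank}E_i$, and the Krein numbers $q_{i,j}^k$ are defined by $E_i\circ E_j=\frac1{|X|}\sum_{k} q_{i,j}^kE_k$, where $\circ$ is the entrywise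 product. The scheme is $Q$-polynomial (with respect to this ordering) if for each $i\in\{0,\ldots,n\}$ there is a polynomial $v_i^*(x)$ of degree $i$ with $Q_{ji}=v_i^*(Q_{j1})$ for all $j\in\{0,\ldots,n\}$. Then $\theta_j^*=Q_{j1}$ are called the dual eigenvalues. A $Q$-polynomial scheme is $Q$-bipartite if $a_i^*:=q_{1,i}^i=0$ for $i=1,\ldots,n$. For $Q$-bipartite schemes the relations are indexed so that $\theta^*_{n-i}=-\theta^*_i$ for all $i$. For a non-empty code $C\subseteq X$ with characteristic column vector $\chi$, the degree set is $S(C)=\{i: 1\le i\le n,\ \chi^\top A_i\chi\ne0\}$ and the degree is $s=|S(C)|$. The code $C$ is a symmetric inner distribution code if $a\in S(C)$ implies $n-a\in S(C)$. *)

theory Defs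
  imports "HOL-Analysis.Analysis" "HOL-Computational_Algebra.Polynomial" "HOL-Number_Theory.Cong"
begin

text \<open>
  The finite point set \<open>X\<close> is the universe of a type of class \<^class>\<open>finite\<close>, so that matrices
  indexed by \<open>X\<close> have type \<open>real^'a^'a\<close>.  The relations \<open>R i\<close>, the idempotents \<open>E i\<close> and all
  the parameters below are families indexed by \<^typ>\<open>nat\<close> of which only the members with index
  at most \<open>n\<close> are meaningful.
\<close>

definition all_ones :: "real^'a^'a"
  where "all_ones = (\<chi> x y. 1)"

definition adjacency_matrix :: "('a \<times> 'a) set \<Rightarrow> real^'a^'a"
  where "adjacency_matrix r = (\<chi> x y. of_bool ((x, y) \<in> r))"

definition bose_mesner :: "nat \<Rightarrow> (nat \<Rightarrow> ('a::finite \<times> 'a) set) \<Rightarrow> (real^'a^'a) set"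
  where "bose_mesner n R = span ((\<lambda>i. adjacency_matrix (R i)) ` {..n})"

definition symmetric_association_scheme :: "nat \<Rightarrow> (nat \<Rightarrow> ('a::finite \<times> 'a) set) \<Rightarrow> bool"
  where "symmetric_association_scheme n R \<longleftrightarrow>
    (\<forall>i\<le>n. R i \<noteq> {}) \<and>
    adjacency_matrix (R 0) = mat 1 \<and>
    (\<Sum>i\<le>n. adjacency_matrix (R i)) = all_ones \<and>
    (\<forall>i\<le>n. transpose (adjacency_matrix (R i)) = adjacency_matrix (R i)) \<and>
    (\<forall>i\<le>n. \<forall>j\<le>n. adjacency_matrix (R i) ** adjacency_matrix (R j) \<in> bose_mesner n R)"

definition primitive_idempotent :: "(real^'a^'a) set \<Rightarrow> real^'a^'a::finite \<Rightarrow> bool"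
  where "primitive_idempotent B e \<longleftrightarrow>
    e \<in> B \<and> e \<noteq> 0 \<and> e ** e = e \<and>
    \<not> (\<exists>f\<in>B. \<exists>g\<in>B. f \<noteq> 0 \<and> g \<noteq> 0 \<and> f ** f = f \<and> g ** g = g \<and>
         f ** g = 0 \<and> g ** f = 0 \<and> e = f + g)"

definition idempotent_ordering ::
    "nat \<Rightarrow> (nat \<Rightarrow> ('a::finite \<times> 'a) set) \<Rightarrow> (nat \<Rightarrow> real^'a^'a) \<Rightarrow> bool"
  where "idempotent_ordering n R E \<longleftrightarrow>
    bij_betw E {..n} {e. primitive_idempotent (bose_mesner n R) e} \<and>
    E 0 = (1 / real CARD('a)) *\<^sub>R all_ones"

text \<open>
  The entry \<open>Q\<^sub>j\<^sub>i\<close>.  In a scheme the adjacency matrices are linearly independent and span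
  the algebra containing \<open>E i\<close>, so the coefficients chosen here exist and are unique
  for \<open>i, j \<le> n\<close>.
\<close>
definition second_eigenmatrix ::
    "nat \<Rightarrow> (nat \<Rightarrow> ('a::finite \<times> 'a) set) \<Rightarrow> (nat \<Rightarrow> real^'a^'a) \<Rightarrow> nat \<Rightarrow> nat \<Rightarrow> real"
  where "second_eigenmatrix n R E j i =
    (SOME c. E i = (1 / real CARD('a)) *\<^sub>R (\<Sum>k\<le>n. c k *\<^sub>R adjacency_matrix (R k))) j"

definition dual_eigenvalue ::
    "nat \<Rightarrow> (nat \<Rightarrow> ('a::finite \<times> 'a) set) \<Rightarrow> (nat \<Rightarrow> real^'a^'a) \<Rightarrow> nat \<Rightarrow> real"
  where "dual_eigenvalue n R E j = second_eigenmatrix n R E j 1"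

definition scheme_multiplicity :: "(nat \<Rightarrow> real^'a^'a::finite) \<Rightarrow> nat \<Rightarrow> nat"
  where "scheme_multiplicity E i = rank (E i)"

text \<open>
  The Krein number \<open>q\<^sub>i\<^sub>,\<^sub>j\<^sup>k\<close>.  The product \<open>*\<close> on \<open>real^'a^'a\<close> is entrywise (the matrix product
  is \<open>**\<close>).  As for \<^const>\<open>second_eigenmatrix\<close>, the coefficients exist and are unique.
\<close>
definition krein_number :: "nat \<Rightarrow> (nat \<Rightarrow> real^'a^'a::finite) \<Rightarrow> nat \<Rightarrow> nat \<Rightarrow> nat \<Rightarrow> real"
  where "krein_number n E i j k =
    (SOME q. E i * E j = (1 / real CARD('a)) *\<^sub>R (\<Sum>l\<le>n. q l *\<^sub>R E l)) k"

definition dual_polynomials ::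
    "nat \<Rightarrow> (nat \<Rightarrow> ('a::finite \<times> 'a) set) \<Rightarrow> (nat \<Rightarrow> real^'a^'a) \<Rightarrow> (nat \<Rightarrow> real poly) \<Rightarrow> bool"
  where "dual_polynomials n R E v \<longleftrightarrow>
    (\<forall>i\<le>n. degree (v i) = i \<and>
      (\<forall>j\<le>n. second_eigenmatrix n R E j i = poly (v i) (second_eigenmatrix n R E j 1)))"

definition Q_polynomial ::
    "nat \<Rightarrow> (nat \<Rightarrow> ('a::finite \<times> 'a) set) \<Rightarrow> (nat \<Rightarrow> real^'a^'a) \<Rightarrow> bool"
  where "Q_polynomial n R E \<longleftrightarrow>
    symmetric_association_scheme n R \<and> idempotent_ordering n R E \<and> (\<exists>v. dual_polynomials n R E v)"

definition Q_bipartite ::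
    "nat \<Rightarrow> (nat \<Rightarrow> ('a::finite \<times> 'a) set) \<Rightarrow> (nat \<Rightarrow> real^'a^'a) \<Rightarrow> bool"
  where "Q_bipartite n R E \<longleftrightarrow>
    Q_polynomial n R E \<and> (\<forall>i\<in>{1..n}. krein_number n E 1 i i = 0)"

definition characteristic_vector :: "'a set \<Rightarrow> real^'a"
  where "characteristic_vector C = (\<chi> x. of_bool (x \<in> C))"

definition degree_set :: "nat \<Rightarrow> (nat \<Rightarrow> ('a::finite \<times> 'a) set) \<Rightarrow> 'a set \<Rightarrow> nat set"
  where "degree_set n R C =
    {i \<in> {1..n}. characteristic_vector C \<bullet> (adjacency_matrix (R i) *v characteristic_vector C) \<noteq> 0}"

definition code_degree :: "nat \<Rightarrow> (nat \<Rightarrow> ('a::finite \<times> 'a) set) \<Rightarrow> 'a set \<Rightarrow> nat"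
  where "code_degree n R C = card (degree_set n R C)"

definition symmetric_inner_distribution ::
    "nat \<Rightarrow> (nat \<Rightarrow> ('a::finite \<times> 'a) set) \<Rightarrow> 'a set \<Rightarrow> bool"
  where "symmetric_inner_distribution n R C \<longleftrightarrow>
    (\<forall>a\<in>degree_set n R C. n - a \<in> degree_set n R C)"

definition Psi_dual :: "(nat \<Rightarrow> real poly) \<Rightarrow> nat \<Rightarrow> real poly"
  where "Psi_dual v s = (\<Sum>i | i \<le> s \<and> [i = s] (mod 2). v i)"

end

theory Submission
  imports Defs
begin

text \<open>
  The proof is the polynomial method. Write \<open>\<theta>\<^sub>j\<close> for the dual eigenvalues, \<open>S\<close> for the degree set
  of \<open>C\<close>, and let \<open>F(x) = \<Prod>\<^bsub>j\<in>S\<^esub> (x - \<theta>\<^sub>j)\<close> be the annihilator of \<open>C\<close>. If \<open>F = \<Sum>\<^sub>k c\<^sub>k v\<^sub>k\<close> then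
  \<open>T = (|X| / F(\<theta>\<^sub>0)) \<Sum>\<^sub>k c\<^sub>k E\<^sub>k\<close> has the entry \<open>F(\<theta>\<^sub>j) / F(\<theta>\<^sub>0)\<close> at each pair of \<open>R\<^sub>j\<close>, hence the
  submatrix of \<open>T\<close> on \<open>C\<close> is the identity matrix; here \<open>F(\<theta>\<^sub>0) \<noteq> 0\<close> since the \<open>\<theta>\<^sub>j\<close> are
  distinct (\<open>dual_eigenvalue_inj\<close>). So \<open>|C|\<close> is at most the sum of the ranks \<open>m\<^sub>k\<close> over
  the indices \<open>k\<close> that occur in the expansion (\<open>card_le_sum_rank\<close>).

  In general all \<open>k \<le> s\<close> can occur. Here only those with the parity of \<open>s\<close> do. First, the symmetry of
  the inner distribution makes \<open>S\<close> invariant under \<open>j \<mapsto> n - j\<close>, which negates the dual eigenvalues,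
  so that \<open>F(-x) = (-1)\<^sup>s F(x)\<close> (\<open>annihilator_parity\<close>). Second, \<open>v\<^sub>k(-x) = (-1)\<^sup>k v\<^sub>k(x)\<close>
  (\<open>dual_polynomial_parity\<close>): the \<open>v\<^sub>k\<close> are orthogonal for the functional that sums \<open>p(\<theta>\<^sub>j)\<close> over all
  pairs of points, because distinct idempotents are orthogonal, and the vanishing of the Krein numbers
  \<open>q\<^sub>1\<^sub>,\<^sub>k\<^sup>k\<close> is the vanishing of the middle coefficients in the three-term recurrence of the \<open>v\<^sub>k\<close>.

  When the bound is attained, let \<open>P\<close> be the coordinate projection onto \<open>C\<close>. From \<open>P T P = P\<close> it
  follows that \<open>T P\<close> is idempotent of rank \<open>|C|\<close>. Its range lies in the sum of the ranges of the \<open>E\<^sub>k\<close>,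
  whose dimension is at most \<open>|C|\<close>, so \<open>T P\<close> fixes each of these ranges and \<open>T P E\<^sub>k = E\<^sub>k\<close>. As \<open>E\<^sub>k\<close>
  has constant diagonal, taking traces gives the same value \<open>c\<^sub>k = F(\<theta>\<^sub>0) / |C|\<close> for every \<open>k\<close>
  (\<open>coefficient_if_tight\<close>). Thus \<open>\<Psi>\<^sub>s\<close> is a nonzero multiple of \<open>F\<close>, and the zeros of \<open>F\<close> are the
  \<open>\<theta>\<^sub>j\<close> with \<open>j \<in> S\<close>. The index \<open>n\<close> is not in \<open>S\<close> because its mirror image \<open>0\<close> is not.
\<close>

section \<open>Orthogonal polynomials and reflection\<close>

lemma poly_expansion:
  fixes v :: "nat \<Rightarrow> real poly"
  assumes "\<And>i. i \<le> d \<Longrightarrow> degree (v i) = i" "v 0 \<noteq> 0" "degree p \<le> d"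
  shows "\<exists>c. p = (\<Sum>k\<le>d. smult (c k) (v k))"
  using assms
proof (induction d arbitrary: p)
  case 0
  obtain a b where "p = [:a:]" "v 0 = [:b:]"
    using 0 by (metis degree_eq_zeroE le_zero_eq)
  moreover from this have "b \<noteq> 0" using 0 by auto
  ultimately have "p = (\<Sum>k\<le>0. smult (a / b) (v k))" by simp
  then show ?case by (rule exI[of _ "\<lambda>_. a / b"])
next
  case (Suc d)
  define c where "c = coeff p (Suc d) / lead_coeff (v (Suc d))"
  have dv: "degree (v (Suc d)) = Suc d" using Suc.prems by blast
  then have "lead_coeff (v (Suc d)) \<noteq> 0"
    by (metis degree_0 leading_coeff_0_iff nat.distinct(1))
  then have "coeff (p - smult c (v (Suc d))) (Suc d) = 0"
    unfolding c_def using dv by simp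
  moreover have "degree (p - smult c (v (Suc d))) \<le> Suc d"
    using Suc.prems dv by (intro degree_diff_le) auto
  ultimately have "degree (p - smult c (v (Suc d))) \<le> d"
    by (metis leading_coeff_0_iff degree_0 le_Suc_eq zero_le)
  with Suc obtain e where e: "p - smult c (v (Suc d)) = (\<Sum>k\<le>d. smult (e k) (v k))"
    by (metis le_Suc_eq)
  have "p = (\<Sum>k\<le>Suc d. smult ((e(Suc d := c)) k) (v k))"
    using e by (simp add: algebra_simps)
  then show ?case by blast
qed

lemma smult_sum_right: "smult a (\<Sum>j\<in>K. f j) = (\<Sum>j\<in>K. smult a (f j))"
  by (induction K rule: infinite_finite_induct) (auto simp: smult_add_right)

text \<open>
  The finite multiset of values \<open>t w\<close> plays the role of a discrete measure. In the three-term
  recurrence \<open>x v\<^sub>k = c v\<^sub>k\<^sub>+\<^sub>1 + a\<^sub>k v\<^sub>k + b v\<^sub>k\<^sub>-\<^sub>1\<close> the hypothesis \<open>diag\<close> says that \<open>a\<^sub>k = 0\<close>, so the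
  parity passes from \<open>v\<^sub>k\<close> and \<open>v\<^sub>k\<^sub>-\<^sub>1\<close> to \<open>v\<^sub>k\<^sub>+\<^sub>1\<close>.
\<close>
lemma orthogonal_poly_parity:
  fixes v :: "nat \<Rightarrow> real poly" and t :: "'w \<Rightarrow> real"
  assumes deg: "\<And>i. i \<le> n \<Longrightarrow> degree (v i) = i"
    and orth: "\<And>i j. i \<le> n \<Longrightarrow> j \<le> n \<Longrightarrow> i \<noteq> j \<Longrightarrow>
      (\<Sum>w\<in>W. poly (v i) (t w) * poly (v j) (t w)) = 0"
    and pos: "\<And>i. i \<le> n \<Longrightarrow> (\<Sum>w\<in>W. (poly (v i) (t w))\<^sup>2) \<noteq> 0"
    and diag: "\<And>i. i < n \<Longrightarrow> (\<Sum>w\<in>W. t w * (poly (v i) (t w))\<^sup>2) = 0"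
  shows "i \<le> n \<Longrightarrow> pcompose (v i) [:0, -1:] = smult ((-1) ^ i) (v i)"
proof (induction i rule: less_induct)
  case (less i)
  define L where "L p = (\<Sum>w\<in>W. poly p (t w))" for p
  have L_add: "L (p + q) = L p + L q" and L_diff: "L (p - q) = L p - L q"
    and L_smult: "L (smult a p) = a * L p" for p q a
    by (simp_all add: L_def sum.distrib sum_subtractf sum_distrib_left)
  have L_sum: "L (\<Sum>k\<in>K. f k) = (\<Sum>k\<in>K. L (f k))" for K :: "nat set" and f
    by (induction K rule: infinite_finite_induct) (auto simp: L_add, auto simp: L_def)
  have L_orth: "L (v i * v j) = 0" if "i \<le> n" "j \<le> n" "i \<noteq> j" for i j
    using orth[OF that] by (simp add: L_def)
  have L_pos: "L (v i * v i) \<noteq> 0" if "i \<le> n" for i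
    using pos[OF that] by (simp add: L_def power2_eq_square)
  have v0: "v 0 \<noteq> 0" using pos[of 0] by auto
  have L_low: "L (p * v i) = 0" if "degree p < i" "i \<le> n" for p i
  proof -
    have "\<exists>c. p = (\<Sum>k\<le>degree p. smult (c k) (v k))"
      by (rule poly_expansion) (use deg v0 that in auto)
    then obtain c where c: "p = (\<Sum>k\<le>degree p. smult (c k) (v k))" ..
    have "L (p * v i) = L ((\<Sum>k\<le>degree p. smult (c k) (v k)) * v i)"
      by (rule arg_cong[OF c, where f = "\<lambda>q. L (q * v i)"])
    also have "\<dots> = (\<Sum>k\<le>degree p. c k * L (v k * v i))"
      by (simp add: sum_distrib_right L_sum L_smult)
    also have "\<dots> = 0" using that by (intro sum.neutral) (auto simp: L_orth)
    finally show ?thesis .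
  qed
  show ?case
  proof (cases i)
    case 0
    then obtain a where "v 0 = [:a:]" using deg[of 0] by (metis degree_eq_zeroE zero_le)
    then show ?thesis using 0 by simp
  next
    case (Suc k)
    have k: "k < n" using Suc less.prems by simp
    define c where "c = lead_coeff (v k) / lead_coeff (v i)"
    have vk: "v k \<noteq> 0" using pos[of k] k by auto
    have "v i \<noteq> 0" using pos[of i] less.prems by auto
    then have c: "c \<noteq> 0" using vk by (simp add: c_def)
    \<comment> \<open>With \<open>c\<close> the leading terms of \<open>x v\<^sub>k\<close> and \<open>c v\<^sub>k\<^sub>+\<^sub>1\<close> cancel.\<close>
    define r where "r = pCons 0 (v k) - smult c (v i)"
    have dk: "degree (v k) = k" and di: "degree (v i) = Suc k"
      using deg k Suc less.prems by auto
    have "degree r \<le> Suc k"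
      unfolding r_def using dk di by (intro degree_diff_le) (simp_all add: degree_pCons_eq_if)
    moreover have "coeff r (Suc k) = 0"
    proof -
      have "coeff (v i) (Suc k) \<noteq> 0" using \<open>v i \<noteq> 0\<close> di by (metis leading_coeff_0_iff)
      then show ?thesis by (simp add: r_def c_def dk di)
    qed
    ultimately have "degree r \<le> k"
      by (metis leading_coeff_0_iff degree_0 le_Suc_eq zero_le)
    then have "\<exists>a. r = (\<Sum>j\<le>k. smult (a j) (v j))"
      by (intro poly_expansion) (use deg v0 k in auto)
    then obtain a where a: "r = (\<Sum>j\<le>k. smult (a j) (v j))" ..
    \<comment> \<open>Only the term of index \<open>k - 1\<close> survives in the expansion of \<open>r\<close>: that of index \<open>k\<close> vanishes by
      \<open>diag\<close>, and those of lower index because \<open>x v\<^sub>j\<close> has degree less than \<open>k\<close>.\<close>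
    have a0: "a j = 0" if "j \<le> k" "Suc j \<noteq> k" for j
    proof -
      have "L (r * v j) = (\<Sum>l\<le>k. a l * L (v l * v j))"
        by (simp add: a sum_distrib_right L_sum L_smult)
      also have "\<dots> = (\<Sum>l\<le>k. if l = j then a l * L (v l * v j) else 0)"
        using that k by (intro sum.cong) (auto simp: L_orth)
      also have "\<dots> = a j * L (v j * v j)" using that by simp
      finally have 1: "L (r * v j) = a j * L (v j * v j)" .
      have "L (r * v j) = L (pCons 0 (v k) * v j) - c * L (v i * v j)"
        by (simp add: r_def left_diff_distrib L_diff L_smult del: mult_pCons_left)
      also have "L (v i * v j) = 0" using that Suc less.prems by (intro L_orth) auto
      also have "L (pCons 0 (v k) * v j) = 0"
      proof (cases "j = k")
        case True
        then show ?thesis using diag[OF k]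
          by (simp add: L_def power2_eq_square mult.assoc)
      next
        case False
        have "L (pCons 0 (v k) * v j) = L (pCons 0 (v j) * v k)"
          by (simp add: mult.commute)
        also have "\<dots> = 0"
          using deg[of j] that False k by (intro L_low) (auto simp: degree_pCons_eq_if)
        finally show ?thesis .
      qed
      finally show ?thesis using 1 L_pos[of j] that k by simp
    qed
    define g where "g = pCons 0 (v k)"
    have "pcompose r [:0, -1:] = smult ((-1) ^ i) r"
      unfolding a pcompose_sum smult_sum_right pcompose_smult
    proof (intro sum.cong refl)
      fix j assume "j \<in> {..k}"
      then show "smult (a j) (pcompose (v j) [:0, -1:]) = smult ((-1) ^ i) (smult (a j) (v j))"
        using a0[of j] less.IH[of j] less.prems Suc by (cases "Suc j = k") (auto simp: mult.commute)
    qed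
    moreover have "pcompose g [:0, -1:] = smult ((-1) ^ i) g"
      using less.IH[of k] k Suc by (simp add: g_def pcompose_pCons)
    moreover have "v i = smult (1 / c) (g - r)"
      using c by (simp add: r_def g_def)
    ultimately show ?thesis
      by (simp add: pcompose_smult pcompose_diff smult_diff_right mult.commute)
  qed
qed

text \<open>
  Averaging the expansion of \<open>p\<close> with its reflection \<open>(-1)\<^sup>d p(-x)\<close> cancels the terms of the wrong
  parity.
\<close>
lemma parity_expansion:
  fixes v :: "nat \<Rightarrow> real poly"
  assumes deg: "\<And>i. i \<le> d \<Longrightarrow> degree (v i) = i" and "v 0 \<noteq> 0"
    and par: "\<And>i. i \<le> d \<Longrightarrow> pcompose (v i) [:0, -1:] = smult ((-1) ^ i) (v i)"
    and "degree p \<le> d" and p: "pcompose p [:0, -1:] = smult ((-1) ^ d) p"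
  shows "\<exists>c. p = (\<Sum>k | k \<le> d \<and> [k = d] (mod 2). smult (c k) (v k))"
proof -
  obtain c where c: "p = (\<Sum>k\<le>d. smult (c k) (v k))"
    using poly_expansion[of d v p] assms by metis
  have "smult 2 p = p + p" by (metis one_add_one smult_1_left smult_add_left)
  also have "\<dots> = p + smult ((-1) ^ d) (pcompose p [:0, -1:])" unfolding p by simp
  also have "\<dots> = (\<Sum>k\<le>d. smult (c k) (v k) + smult (c k * (-1) ^ (d + k)) (v k))"
    unfolding c pcompose_sum smult_sum_right pcompose_smult sum.distrib
    by (intro arg_cong2[where f = "(+)"] sum.cong refl) (simp add: par power_add mult_ac)
  also have "\<dots> = (\<Sum>k\<le>d. if [k = d] (mod 2) then smult 2 (smult (c k) (v k)) else 0)"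
    by (intro sum.cong refl)
       (auto simp: cong_def minus_one_power_iff smult_add_left[symmetric] mod2_eq_if split: if_splits)
  also have "\<dots> = smult 2 (\<Sum>k | k \<le> d \<and> [k = d] (mod 2). smult (c k) (v k))"
    unfolding smult_sum_right by (simp add: sum.If_cases Int_def)
  finally have "p = (\<Sum>k | k \<le> d \<and> [k = d] (mod 2). smult (c k) (v k))"
    by (metis smult_cancel zero_neq_numeral)
  then show ?thesis by blast
qed

text \<open>
  Reflection turns the factor of \<open>i\<close> into minus the factor of \<open>n - i\<close>.
\<close>
lemma annihilator_parity:
  fixes \<theta> :: "nat \<Rightarrow> real"
  assumes S: "S \<subseteq> {..n}" and closed: "\<And>i. i \<in> S \<Longrightarrow> n - i \<in> S"
    and sym: "\<And>i. i \<in> S \<Longrightarrow> \<theta> (n - i) = - \<theta> i"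
  shows "pcompose (\<Prod>i\<in>S. [:- \<theta> i, 1:]) [:0, -1:] =
    smult ((-1) ^ card S) (\<Prod>i\<in>S. [:- \<theta> i, 1:])"
proof -
  have "pcompose (\<Prod>i\<in>S. [:- \<theta> i, 1:]) [:0, -1:] = (\<Prod>i\<in>S. smult (-1) [:- \<theta> (n - i), 1:])"
    unfolding pcompose_prod by (intro prod.cong refl) (simp add: sym pcompose_pCons)
  also have "\<dots> = smult ((-1) ^ card S) (\<Prod>i\<in>S. [:- \<theta> (n - i), 1:])"
    unfolding prod_smult by simp
  also have "(\<Prod>i\<in>S. [:- \<theta> (n - i), 1:]) = (\<Prod>i\<in>S. [:- \<theta> i, 1:])"
    by (rule prod.reindex_bij_witness[of _ "\<lambda>i. n - i" "\<lambda>i. n - i"]) (use S closed in auto)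
  finally show ?thesis .
qed

lemma poly_map_poly_prod_linear:
  "poly (map_poly complex_of_real (\<Prod>i\<in>S. [:- b i, 1:])) z = (\<Prod>i\<in>S. z - of_real (b i))"
proof (induction S rule: infinite_finite_induct)
  case (insert i S)
  have map_diff: "map_poly complex_of_real (p - q) = map_poly of_real p - map_poly of_real q" for p q
    by (simp add: poly_eq_iff coeff_map_poly)
  show ?case
    using insert by (simp add: map_diff map_poly_smult map_poly_pCons left_diff_distrib)
qed simp_all

lemma order_prod_linear:
  fixes b :: "'i \<Rightarrow> 'k::field"
  assumes "finite S" "inj_on b S" "i \<in> S"
  shows "order (b i) (\<Prod>j\<in>S. [:- b j, 1:]) = 1"
proof -
  let ?G = "\<Prod>j\<in>S - {i}. [:- b j, 1:]"
  have "poly ?G (b i) \<noteq> 0"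
    using assms by (auto simp: poly_prod inj_on_def)
  moreover from this have "[:- b i, 1:] * ?G \<noteq> 0"
    by (metis mult_eq_0_iff pCons_eq_0_iff one_neq_zero poly_0)
  moreover have "order (b i) [:- b i, 1:] = 1" using order_power_n_n[of "b i" 1] by simp
  ultimately show ?thesis
    using assms by (simp add: prod.remove[of S i] order_mult order_0I del: mult_pCons_left)
qed

section \<open>Linear combinations of idempotents that are the identity on a code\<close>

text \<open>
  The sum of the ranges is spanned by the union of bases of the single ranges.
\<close>
lemma dim_span_ranges_le:
  fixes E :: "'i \<Rightarrow> real^'m^'n"
  assumes "finite I"
  shows "dim (span (\<Union>i\<in>I. range ((*v) (E i)))) \<le> (\<Sum>i\<in>I. rank (E i))"
proof -
  have "\<exists>b. b \<subseteq> range ((*v) (E i)) \<and> independent b \<and> range ((*v) (E i)) \<subseteq> span b \<and>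
    card b = rank (E i)" for i
    unfolding rank_dim_range by (rule basis_exists) blast
  then obtain b where b: "\<And>i. independent (b i)" "\<And>i. range ((*v) (E i)) \<subseteq> span (b i)"
      "\<And>i. card (b i) = rank (E i)"
    by metis
  have fin: "finite (\<Union>i\<in>I. b i)"
    using assms b(1) by (auto intro: finiteI_independent)
  have "range ((*v) (E i)) \<subseteq> span (\<Union>i\<in>I. b i)" if "i \<in> I" for i
    using b(2)[of i] span_mono[of "b i" "\<Union>i\<in>I. b i"] that by blast
  then have "(\<Union>i\<in>I. range ((*v) (E i))) \<subseteq> span (\<Union>i\<in>I. b i)" by blast
  then have "dim (\<Union>i\<in>I. range ((*v) (E i))) \<le> card (\<Union>i\<in>I. b i)"
    using fin by (rule dim_le_card)
  also have "\<dots> \<le> (\<Sum>i\<in>I. card (b i))" by (rule card_UN_le[OF assms])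
  finally show ?thesis by (simp add: b(3))
qed

definition restriction_projection :: "'a set \<Rightarrow> real^'a^'a"
  where "restriction_projection C = (\<chi> x y. of_bool (x = y \<and> x \<in> C))"

lemma restriction_projection_left:
  "(restriction_projection C ** M) $ x $ y = of_bool (x \<in> C) * M $ x $ y"
proof -
  have "(restriction_projection C ** M) $ x $ y =
      (\<Sum>z\<in>UNIV. if z = x then of_bool (x \<in> C) * M $ z $ y else 0)"
    unfolding matrix_matrix_mult_def restriction_projection_def
    by (simp only: vec_lambda_beta, intro sum.cong) auto
  then show ?thesis by simp
qed

lemma restriction_projection_right:
  "(M ** restriction_projection C) $ x $ y = M $ x $ y * of_bool (y \<in> C)"
proof -
  have "(M ** restriction_projection C) $ x $ y =
      (\<Sum>z\<in>UNIV. if z = y then M $ x $ z * of_bool (y \<in> C) else 0)"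
    unfolding matrix_matrix_mult_def restriction_projection_def
    by (simp only: vec_lambda_beta, intro sum.cong) auto
  then show ?thesis by simp
qed

lemma card_le_rank_restriction_projection:
  "card C \<le> rank (restriction_projection C :: real^'a^'a::finite)"
proof -
  let ?B = "(\<lambda>x. axis x 1 :: real^'a) ` C"
  have "restriction_projection C *v axis x 1 = axis x 1" if "x \<in> C" for x
    unfolding matrix_vector_mult_basis
    using that by (auto simp: column_def restriction_projection_def vec_eq_iff axis_def)
  then have "?B \<subseteq> range ((*v) (restriction_projection C))"
    by (metis (no_types, lifting) image_subsetI rangeI)
  moreover have "independent ?B"
    by (rule independent_mono[OF independent_Basis]) (auto simp: Basis_vec_def)
  ultimately have "card ?B \<le> rank (restriction_projection C :: real^'a^'a)"
    unfolding rank_dim_range by (rule independent_card_le_dim)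
  moreover have "inj_on (\<lambda>x. axis x 1 :: real^'a) C" by (auto simp: inj_on_def axis_eq_axis)
  ultimately show ?thesis by (simp add: card_image)
qed

text \<open>
  With \<open>P\<close> the coordinate projection onto \<open>C\<close>, the hypothesis \<open>id\<close> reads \<open>P T P = P\<close>. Then \<open>T P\<close> is
  idempotent and has rank at least \<open>|C|\<close>, while its range lies in the sum \<open>W\<close> of the ranges of the
  \<open>E i\<close>. If \<open>|C|\<close> is the largest value that this allows, then \<open>T P\<close> has range \<open>W\<close> and, being
  idempotent, is the identity there.
\<close>
lemma identity_on_code:
  fixes E :: "'i \<Rightarrow> real^'a^'a::finite"
  assumes I: "finite I"
    and T: "T = (\<Sum>i\<in>I. c i *\<^sub>R E i)"
    and id: "\<And>x y. x \<in> C \<Longrightarrow> y \<in> C \<Longrightarrow> T $ x $ y = of_bool (x = y)"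
  shows card_le_sum_rank: "card C \<le> (\<Sum>i\<in>I. rank (E i))"
    and fixes_ranges_if_tight:
      "card C = (\<Sum>i\<in>I. rank (E i)) \<Longrightarrow> i \<in> I \<Longrightarrow> (T ** restriction_projection C) ** E i = E i"
proof -
  define P :: "real^'a^'a" where "P = restriction_projection C"
  define W where "W = span (\<Union>i\<in>I. range ((*v) (E i)))"
  define N where "N = T ** P"
  have PN: "P ** N = P"
    unfolding vec_eq_iff N_def P_def restriction_projection_left restriction_projection_right
    by (auto simp: restriction_projection_def id of_bool_def)
  have "N *v u \<in> W" for u
  proof -
    have "N *v u = (\<Sum>i\<in>I. c i *\<^sub>R (E i *v (P *v u)))"
      unfolding N_def T matrix_vector_mul_assoc[symmetric]
      by (induction I rule: infinite_finite_induct)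
         (simp_all add: matrix_vector_mult_add_rdistrib scaleR_matrix_vector_assoc)
    also have "\<dots> \<in> W" unfolding W_def by (intro span_sum span_scale span_base) auto
    finally show ?thesis .
  qed
  then have N_W: "range ((*v) N) \<subseteq> W" by blast
  have "card C \<le> rank N"
    using card_le_rank_restriction_projection[of C] rank_mul_le_right[of P N]
    unfolding PN P_def[symmetric] by linarith
  then have C_N: "card C \<le> dim (range ((*v) N))" by (simp add: rank_dim_range)
  have W_dim: "dim W \<le> (\<Sum>i\<in>I. rank (E i))"
    unfolding W_def by (rule dim_span_ranges_le[OF I])
  show "card C \<le> (\<Sum>i\<in>I. rank (E i))"
    using C_N dim_subset[OF N_W] W_dim by linarith
  show "(T ** restriction_projection C) ** E i = E i"
    if "card C = (\<Sum>i\<in>I. rank (E i))" "i \<in> I"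
  proof -
    have "range ((*v) N) = W"
    proof (rule subspace_dim_equal[OF _ _ N_W])
      show "subspace (range ((*v) N))"
        by (intro linear_subspace_image) auto
      show "subspace W" by (simp add: W_def)
      show "dim W \<le> dim (range ((*v) N))" using C_N W_dim that by linarith
    qed
    moreover have "N ** N = N"
      by (metis N_def PN matrix_mul_assoc)
    moreover have "E i *v u \<in> W" for u
      unfolding W_def using that by (intro span_base) auto
    ultimately have "N *v (E i *v u) = E i *v u" for u
      by (metis (no_types, lifting) imageE matrix_vector_mul_assoc)
    then show ?thesis
      unfolding P_def[symmetric] N_def[symmetric] by (simp add: matrix_eq matrix_vector_mul_assoc)
  qed
qed

text \<open>
  Compute the trace of \<open>T P E\<^sub>i = E\<^sub>i\<close> twice. On the right it is \<open>|X| d\<close>; on the left, moving \<open>E\<^sub>i\<close> to the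
  front leaves \<open>c\<^sub>i\<close> times the trace of \<open>E\<^sub>i P\<close>, which is \<open>|C| d\<close>.
\<close>
lemma coefficient_if_tight:
  fixes E :: "'i \<Rightarrow> real^'a^'a::finite"
  assumes I: "finite I"
    and T: "T = (\<Sum>i\<in>I. c i *\<^sub>R E i)"
    and id: "\<And>x y. x \<in> C \<Longrightarrow> y \<in> C \<Longrightarrow> T $ x $ y = of_bool (x = y)"
    and tight: "card C = (\<Sum>i\<in>I. rank (E i))"
    and orth: "\<And>i j. i \<in> I \<Longrightarrow> j \<in> I \<Longrightarrow> E i ** E j = (if i = j then E i else 0)"
    and i: "i \<in> I"
    and diag: "\<And>x. E i $ x $ x = d" and "d \<noteq> 0"
  shows "c i * real (card C) = real CARD('a)"
proof -
  define P :: "real^'a^'a" where "P = restriction_projection C"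
  have "E i ** T = (\<Sum>j\<in>I. c j *\<^sub>R (E i ** E j))"
    unfolding T
    by (induction I rule: infinite_finite_induct)
       (simp_all add: matrix_add_ldistrib matrix_scalar_ac scalar_matrix_assoc)
  also have "\<dots> = (\<Sum>j\<in>I. if j = i then c i *\<^sub>R E i else 0)"
    using i by (intro sum.cong) (auto simp: orth)
  also have "\<dots> = c i *\<^sub>R E i" using I i by simp
  finally have ET: "E i ** T = c i *\<^sub>R E i" .
  have fixed: "(T ** P) ** E i = E i"
    unfolding P_def by (rule fixes_ranges_if_tight[OF I T _ tight i]) (rule id)
  have "real CARD('a) * d = trace (E i)" by (simp add: trace_def diag)
  also have "\<dots> = trace ((T ** P) ** E i)"
    by (simp only: fixed)
  also have "\<dots> = trace ((c i *\<^sub>R E i) ** P)"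
    by (metis ET trace_mul_sym matrix_mul_assoc)
  also have "\<dots> = (\<Sum>x\<in>UNIV. if x \<in> C then c i * d else 0)"
    unfolding trace_def P_def restriction_projection_right
    by (intro sum.cong) (auto simp: diag)
  also have "\<dots> = c i * real (card C) * d" by (simp add: sum.If_cases)
  finally show ?thesis using \<open>d \<noteq> 0\<close> by simp
qed

section \<open>The Bose--Mesner algebra\<close>

lemma matrix_mult_add_left: "(A + B) ** C = A ** C + B ** (C :: real^'p^'n)"
  by (simp add: matrix_matrix_mult_def vec_eq_iff sum.distrib distrib_right)

locale association_scheme =
  fixes n :: nat and R :: "nat \<Rightarrow> ('a::finite \<times> 'a) set"
  assumes scheme: "symmetric_association_scheme n R"
begin

lemma ex1_relation: "\<exists>!i. i \<le> n \<and> (x, y) \<in> R i"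
proof -
  have "(\<Sum>i\<le>n. adjacency_matrix (R i)) $ x $ y = 1"
    using scheme by (simp add: symmetric_association_scheme_def all_ones_def)
  then have "real (card {i. i \<le> n \<and> (x, y) \<in> R i}) = 1"
    by (simp add: adjacency_matrix_def of_bool_def sum.If_cases Int_def)
  then have "card {i. i \<le> n \<and> (x, y) \<in> R i} = 1" by linarith
  then obtain i where "{i. i \<le> n \<and> (x, y) \<in> R i} = {i}"
    by (auto simp: card_1_singleton_iff)
  then have "j \<le> n \<and> (x, y) \<in> R j \<longleftrightarrow> j = i" for j by blast
  then show ?thesis by metis
qed

definition relation_index :: "'a \<Rightarrow> 'a \<Rightarrow> nat"
  where "relation_index x y = (THE i. i \<le> n \<and> (x, y) \<in> R i)"

lemma relation_index_le: "relation_index x y \<le> n" and relation_index_mem: "(x, y) \<in> R (relation_index x y)"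
  using theI'[OF ex1_relation] unfolding relation_index_def by blast+

lemma mem_relation_iff: "i \<le> n \<Longrightarrow> (x, y) \<in> R i \<longleftrightarrow> relation_index x y = i"
  using ex1_relation[of x y] relation_index_le[of x y] relation_index_mem[of x y] by blast

lemma relation_index_eq_0_iff: "relation_index x y = 0 \<longleftrightarrow> x = y"
proof -
  have "adjacency_matrix (R 0) $ x $ y = (mat 1 :: real^'a^'a) $ x $ y"
    using scheme by (simp add: symmetric_association_scheme_def)
  then show ?thesis
    using mem_relation_iff[of 0 x y]
    by (auto simp: adjacency_matrix_def mat_def split: if_splits)
qed

lemma ex_relation_index_eq: "i \<le> n \<Longrightarrow> \<exists>x y. relation_index x y = i"
  using scheme mem_relation_iff unfolding symmetric_association_scheme_def
  by (metis ex_in_conv surj_pair)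

lemma relation_index_commute: "relation_index x y = relation_index y x"
proof -
  have "transpose (adjacency_matrix (R (relation_index x y))) $ y $ x = adjacency_matrix (R (relation_index x y)) $ y $ x"
    using scheme relation_index_le by (simp add: symmetric_association_scheme_def)
  then have "(y, x) \<in> R (relation_index x y)"
    using relation_index_mem[of x y] by (simp add: transpose_def adjacency_matrix_def)
  then show ?thesis using mem_relation_iff[OF relation_index_le] by metis
qed

lemma adjacency_entry: "i \<le> n \<Longrightarrow> adjacency_matrix (R i) $ x $ y = of_bool (relation_index x y = i)"
  by (simp add: adjacency_matrix_def mem_relation_iff)

lemma sum_adjacency_entry:
  "(\<Sum>i\<le>n. c i *\<^sub>R adjacency_matrix (R i)) $ x $ y = c (relation_index x y)"
proof -
  have "(\<Sum>i\<le>n. c i *\<^sub>R adjacency_matrix (R i)) $ x $ y =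
      (\<Sum>i\<le>n. if i = relation_index x y then c i else 0)"
    unfolding sum_component vector_scaleR_component
    by (intro sum.cong) (auto simp: adjacency_entry)
  then show ?thesis using relation_index_le by simp
qed

lemma subspace_bose_mesner: "subspace (bose_mesner n R)"
  by (simp add: bose_mesner_def)

text \<open>
  Working with matrices that are constant on relations makes closure under the entrywise product and
  symmetry immediate; only closure under the matrix product needs the span.
\<close>
lemma bose_mesner_iff: "M \<in> bose_mesner n R \<longleftrightarrow> (\<exists>c. \<forall>x y. M $ x $ y = c (relation_index x y))"
proof
  assume "M \<in> bose_mesner n R"
  then show "\<exists>c. \<forall>x y. M $ x $ y = c (relation_index x y)"
    unfolding bose_mesner_def
  proof (induction rule: span_induct_alt)
    case base
    show ?case by (rule exI[of _ "\<lambda>_. 0"]) simp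
  next
    case (step a A M)
    then obtain c i where "i \<le> n" "A = adjacency_matrix (R i)" "\<forall>x y. M $ x $ y = c (relation_index x y)"
      by blast
    then have "\<forall>x y. (a *\<^sub>R A + M) $ x $ y = (\<lambda>j. a * of_bool (j = i) + c j) (relation_index x y)"
      by (simp add: adjacency_entry)
    then show ?case by (intro exI[of _ "\<lambda>j. a * of_bool (j = i) + c j"]) simp
  qed
next
  assume "\<exists>c. \<forall>x y. M $ x $ y = c (relation_index x y)"
  then obtain c where "\<forall>x y. M $ x $ y = c (relation_index x y)" ..
  then have "M = (\<Sum>i\<le>n. c i *\<^sub>R adjacency_matrix (R i))"
    unfolding vec_eq_iff sum_adjacency_entry .
  also have "\<dots> \<in> bose_mesner n R"
    unfolding bose_mesner_def by (intro span_sum span_scale span_base) auto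
  finally show "M \<in> bose_mesner n R" .
qed

lemma bose_mesner_transpose: "M \<in> bose_mesner n R \<Longrightarrow> transpose M = M"
  using relation_index_commute by (auto simp: bose_mesner_iff transpose_def vec_eq_iff)

lemma bose_mesner_mult:
  assumes "M \<in> bose_mesner n R" "N \<in> bose_mesner n R"
  shows "M ** N \<in> bose_mesner n R"
proof -
  have sub: "subspace {M. M ** N \<in> bose_mesner n R}" "subspace {M. N ** M \<in> bose_mesner n R}"
    for N :: "real^'a^'a"
    using subspace_bose_mesner
    by (auto simp: subspace_def matrix_add_ldistrib matrix_mult_add_left matrix_scalar_ac
        scalar_matrix_assoc[symmetric])
  \<comment> \<open>The product is bilinear, so linearity in \<open>N\<close> and then in \<open>M\<close> reduces to adjacency matrices.\<close>
  have "adjacency_matrix (R i) ** N \<in> bose_mesner n R" if "i \<le> n" for i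
    using assms(2) unfolding bose_mesner_def
  proof (rule span_induct)
    show "subspace {N. adjacency_matrix (R i) ** N \<in> span ((\<lambda>i. adjacency_matrix (R i)) ` {..n})}"
      using sub(2) unfolding bose_mesner_def by blast
  next
    fix A assume "A \<in> (\<lambda>i. adjacency_matrix (R i)) ` {..n}"
    then show "adjacency_matrix (R i) ** A \<in> span ((\<lambda>i. adjacency_matrix (R i)) ` {..n})"
      using scheme that by (auto simp: symmetric_association_scheme_def bose_mesner_def)
  qed
  then have "(\<lambda>i. adjacency_matrix (R i)) ` {..n} \<subseteq> {M. M ** N \<in> bose_mesner n R}" by auto
  from span_minimal[OF this sub(1)] assms(1) show ?thesis
    unfolding bose_mesner_def by blast
qed

text \<open>
  Every matrix of the algebra is symmetric, so \<open>M N = (M N)\<^sup>T = N\<^sup>T M\<^sup>T = N M\<close>.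
\<close>
lemma bose_mesner_commute:
  assumes "M \<in> bose_mesner n R" "N \<in> bose_mesner n R"
  shows "M ** N = N ** M"
  using assms by (metis bose_mesner_mult bose_mesner_transpose matrix_transpose_mul)

text \<open>
  The quadratic form counts the pairs of \<open>C\<close> that lie in \<open>R\<^sub>i\<close>.
\<close>
lemma mem_degree_set_iff:
  "i \<in> degree_set n R C \<longleftrightarrow> 1 \<le> i \<and> i \<le> n \<and> (\<exists>x\<in>C. \<exists>y\<in>C. relation_index x y = i)"
proof (cases "i \<le> n")
  case True
  define f where "f x y = (of_bool (x \<in> C) * (of_bool (relation_index x y = i) * of_bool (y \<in> C)) :: real)" for x y
  have f: "f x y \<ge> 0" for x y by (simp add: f_def)
  have "characteristic_vector C \<bullet> (adjacency_matrix (R i) *v characteristic_vector C) =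
      (\<Sum>x\<in>UNIV. \<Sum>y\<in>UNIV. f x y)"
    unfolding inner_vec_def matrix_vector_mult_def characteristic_vector_def f_def
    by (simp only: vec_lambda_beta adjacency_entry[OF True] sum_distrib_left inner_real_def)
  also have "\<dots> = 0 \<longleftrightarrow> (\<forall>x\<in>UNIV. (\<Sum>y\<in>UNIV. f x y) = 0)"
    by (rule sum_nonneg_eq_0_iff) (simp_all add: sum_nonneg f)
  also have "\<dots> \<longleftrightarrow> (\<forall>x\<in>UNIV. \<forall>y\<in>UNIV. f x y = 0)"
    by (intro ball_cong refl sum_nonneg_eq_0_iff) (simp_all add: f)
  also have "\<dots> \<longleftrightarrow> \<not> (\<exists>x\<in>C. \<exists>y\<in>C. relation_index x y = i)"
    by (auto simp: f_def)
  finally show ?thesis using True by (auto simp: degree_set_def)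
qed (simp add: degree_set_def)

end

section \<open>Idempotents and dual polynomials\<close>

lemma inner_matrix_eq_trace:
  fixes M N :: "real^'a^'a::finite"
  shows "M \<bullet> N = trace (M ** transpose N)"
  by (simp add: inner_vec_def trace_def matrix_matrix_mult_def transpose_def)

lemma inner_matrix_eq_sum:
  fixes M N :: "real^'a^'a::finite"
  shows "M \<bullet> N = (\<Sum>(x, y)\<in>UNIV. M $ x $ y * N $ x $ y)"
  by (simp add: inner_vec_def sum.cartesian_product flip: UNIV_Times_UNIV)

locale ordered_association_scheme = association_scheme n R
  for n :: nat and R :: "nat \<Rightarrow> ('a::finite \<times> 'a) set" +
  fixes E :: "nat \<Rightarrow> real^'a^'a"
  assumes ordering: "idempotent_ordering n R E"
begin

lemma E_primitive: "i \<le> n \<Longrightarrow> primitive_idempotent (bose_mesner n R) (E i)"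
  using ordering unfolding idempotent_ordering_def bij_betw_def by blast

lemma E_mem: "i \<le> n \<Longrightarrow> E i \<in> bose_mesner n R"
  and E_nonzero: "i \<le> n \<Longrightarrow> E i \<noteq> 0"
  and E_idem: "i \<le> n \<Longrightarrow> E i ** E i = E i"
  using E_primitive unfolding primitive_idempotent_def by blast+

lemma E_inj: "inj_on E {..n}"
  using ordering unfolding idempotent_ordering_def bij_betw_def by blast

lemma E_0: "E 0 = (1 / real CARD('a)) *\<^sub>R all_ones"
  using ordering unfolding idempotent_ordering_def by blast

text \<open>
  Otherwise \<open>e = f + (e - f)\<close> would split \<open>e\<close> into two nonzero orthogonal idempotents.
\<close>
lemma primitive_absorbs:
  assumes e: "primitive_idempotent (bose_mesner n R) e"
    and f: "f \<in> bose_mesner n R" "f ** f = f" "e ** f = f"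
  shows "f = 0 \<or> f = e"
proof (rule ccontr)
  assume "\<not> ?thesis"
  then have "f \<noteq> 0" "e - f \<noteq> 0" by auto
  have eB: "e \<in> bose_mesner n R" "e ** e = e"
    using e by (auto simp: primitive_idempotent_def)
  have fe: "f ** e = f" using bose_mesner_commute eB f by metis
  have "e - f \<in> bose_mesner n R" using eB f subspace_bose_mesner by (simp add: subspace_diff)
  moreover have sub_r: "(M - N) ** K = M ** K - N ** K" and sub_l: "K ** (M - N) = K ** M - K ** N"
    for M N K :: "real^'a^'a"
    by (metis add_diff_cancel diff_add_cancel matrix_mult_add_left)
       (metis add_diff_cancel diff_add_cancel matrix_add_ldistrib)
  moreover have "(e - f) ** (e - f) = e - f" "f ** (e - f) = 0" "(e - f) ** f = 0"
    by (simp_all add: sub_r sub_l eB f fe)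
  ultimately show False
    using e f \<open>f \<noteq> 0\<close> \<open>e - f \<noteq> 0\<close> unfolding primitive_idempotent_def
    by (metis add.commute diff_add_cancel)
qed

lemma E_mult: "i \<le> n \<Longrightarrow> j \<le> n \<Longrightarrow> E i ** E j = (if i = j then E i else 0)"
proof (cases "i = j")
  case False
  assume ij: "i \<le> n" "j \<le> n"
  \<comment> \<open>The product is an idempotent below both factors, so by primitivity it is zero or equal to both.\<close>
  define f where "f = E i ** E j"
  have comm: "E i ** E j = E j ** E i"
    using ij E_mem bose_mesner_commute by blast
  have f: "f \<in> bose_mesner n R"
    unfolding f_def using ij E_mem bose_mesner_mult by blast
  have fi: "E i ** f = f" and fj: "E j ** f = f"
    using ij E_idem comm unfolding f_def by (metis matrix_mul_assoc)+
  then have "f ** f = f" unfolding f_def by (metis matrix_mul_assoc)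
  with f fi fj ij have "f = 0 \<or> f = E i" "f = 0 \<or> f = E j"
    using E_primitive primitive_absorbs by blast+
  moreover have "E i \<noteq> E j" using E_inj ij False by (auto simp: inj_on_def)
  ultimately show ?thesis using False f_def by auto
qed (simp add: E_idem)

lemma inner_E:
  assumes "i \<le> n" "j \<le> n"
  shows "E i \<bullet> E j = (if i = j then trace (E i) else 0)"
  using assms E_mem bose_mesner_transpose E_mult
  by (simp add: inner_matrix_eq_trace trace_def)

text \<open>
  The \<open>n + 1\<close> idempotents are orthogonal and nonzero, hence independent, and the algebra is spanned by
  \<open>n + 1\<close> adjacency matrices, so a dimension count suffices.
\<close>
lemma E_spans:
  assumes "M \<in> bose_mesner n R"
  shows "\<exists>q. M = (\<Sum>l\<le>n. q l *\<^sub>R E l)"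
proof -
  have indep: "independent (E ` {..n})"
  proof (rule pairwise_orthogonal_independent)
    show "pairwise orthogonal (E ` {..n})"
      by (auto simp: pairwise_def orthogonal_def inner_E)
    show "0 \<notin> E ` {..n}" using E_nonzero by auto
  qed
  have "dim (bose_mesner n R) \<le> card ((\<lambda>i. adjacency_matrix (R i)) ` {..n})"
    by (rule dim_le_card) (auto simp: bose_mesner_def)
  also have "\<dots> \<le> card (E ` {..n})"
    using card_image[OF E_inj] card_image_le[of "{..n}"] by simp
  finally have "bose_mesner n R \<subseteq> span (E ` {..n})"
    using indep E_mem by (intro card_ge_dim_independent) auto
  then have "M \<in> span (E ` {..n})" using assms by blast
  then obtain u where "M = (\<Sum>e\<in>E ` {..n}. u e *\<^sub>R e)"
    by (auto simp: span_finite)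
  also have "\<dots> = (\<Sum>l\<le>n. u (E l) *\<^sub>R E l)"
    by (simp add: sum.reindex[OF E_inj])
  finally show ?thesis by (rule exI[of _ "\<lambda>l. u (E l)"])
qed

lemma E_entry:
  assumes "i \<le> n"
  shows "E i $ x $ y = second_eigenmatrix n R E (relation_index x y) i / real CARD('a)"
proof -
  obtain c where c: "\<And>x y. E i $ x $ y = c (relation_index x y)"
    using E_mem[OF assms] bose_mesner_iff by blast
  have "E i = (1 / real CARD('a)) *\<^sub>R
      (\<Sum>k\<le>n. (real CARD('a) * c k) *\<^sub>R adjacency_matrix (R k))"
    unfolding vec_eq_iff vector_scaleR_component sum_adjacency_entry by (simp add: c)
  then have "E i = (1 / real CARD('a)) *\<^sub>R
      (\<Sum>k\<le>n. second_eigenmatrix n R E k i *\<^sub>R adjacency_matrix (R k))"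
    unfolding second_eigenmatrix_def
    by (rule someI[of "\<lambda>c. E i = (1 / real CARD('a)) *\<^sub>R (\<Sum>k\<le>n. c k *\<^sub>R adjacency_matrix (R k))"])
  from arg_cong[OF this, where f = "\<lambda>M. M $ x $ y"] show ?thesis
    unfolding vector_scaleR_component sum_adjacency_entry by simp
qed

lemma entrywise_product_krein:
  assumes "i \<le> n" "j \<le> n"
  shows "E i * E j = (1 / real CARD('a)) *\<^sub>R (\<Sum>l\<le>n. krein_number n E i j l *\<^sub>R E l)"
proof -
  obtain c d where "\<And>x y. E i $ x $ y = c (relation_index x y)" "\<And>x y. E j $ x $ y = d (relation_index x y)"
    using E_mem assms bose_mesner_iff by meson
  then have "real CARD('a) *\<^sub>R (E i * E j) \<in> bose_mesner n R"
    unfolding bose_mesner_iff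
    by (intro exI[of _ "\<lambda>k. real CARD('a) * (c k * d k)"]) simp
  then obtain q where q: "real CARD('a) *\<^sub>R (E i * E j) = (\<Sum>l\<le>n. q l *\<^sub>R E l)"
    using E_spans by blast
  have "E i * E j = (1 / real CARD('a)) *\<^sub>R (real CARD('a) *\<^sub>R (E i * E j))" by simp
  then have "E i * E j = (1 / real CARD('a)) *\<^sub>R (\<Sum>l\<le>n. q l *\<^sub>R E l)" unfolding q .
  then show ?thesis unfolding krein_number_def
    by (rule someI[of "\<lambda>q. E i * E j = (1 / real CARD('a)) *\<^sub>R (\<Sum>l\<le>n. q l *\<^sub>R E l)"])
qed

text \<open>
  Turns the vanishing of a Krein number into the vanishing of a sum over all pairs of points: the inner
  product sums the entries of \<open>E\<^sub>i \<circ> E\<^sub>j \<circ> E\<^sub>k\<close>.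
\<close>
lemma krein_as_inner:
  assumes "i \<le> n" "j \<le> n" "k \<le> n"
  shows "(E i * E j) \<bullet> E k = krein_number n E i j k * trace (E k) / real CARD('a)"
proof -
  have "(E i * E j) \<bullet> E k =
      (\<Sum>l\<le>n. krein_number n E i j l * (E l \<bullet> E k)) / real CARD('a)"
    by (simp add: entrywise_product_krein[OF assms(1,2)] inner_sum_left)
  also have "(\<Sum>l\<le>n. krein_number n E i j l * (E l \<bullet> E k)) =
      (\<Sum>l\<le>n. if l = k then krein_number n E i j k * trace (E k) else 0)"
    using assms by (intro sum.cong) (auto simp: inner_E)
  finally show ?thesis using assms by simp
qed

text \<open>
  The diagonal is the relation \<open>R\<^sub>0\<close>, and the trace of \<open>E\<^sub>i\<close> is its squared norm.
\<close>
lemma E_diagonal: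
  assumes "i \<le> n"
  shows "\<exists>d. d \<noteq> 0 \<and> (\<forall>x. E i $ x $ x = d)"
proof -
  obtain c where c: "\<And>x y. E i $ x $ y = c (relation_index x y)"
    using E_mem[OF assms] bose_mesner_iff by blast
  have "relation_index x x = 0" for x using relation_index_eq_0_iff by blast
  then have d: "E i $ x $ x = c 0" for x using c by simp
  have "trace (E i) \<noteq> 0"
    using inner_E[OF assms assms] E_nonzero[OF assms] by (metis inner_eq_zero_iff)
  then have "c 0 \<noteq> 0" by (auto simp: trace_def d)
  then show ?thesis using d by blast
qed

text \<open>
  If \<open>\<theta>\<^sub>j = \<theta>\<^sub>k\<close> then each \<open>E\<^sub>i\<close> takes equal values on \<open>R\<^sub>j\<close> and \<open>R\<^sub>k\<close>. As the \<open>E\<^sub>i\<close> span the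
  algebra, the same holds for \<open>A\<^sub>j\<close>, which is \<open>1\<close> on \<open>R\<^sub>j\<close> and \<open>0\<close> on every other relation.
\<close>
lemma dual_eigenvalue_inj:
  assumes v: "dual_polynomials n R E v"
  shows "inj_on (dual_eigenvalue n R E) {..n}"
proof (rule inj_onI)
  fix j k assume jk: "j \<in> {..n}" "k \<in> {..n}" "dual_eigenvalue n R E j = dual_eigenvalue n R E k"
  obtain x y x' y' where xy: "relation_index x y = j" "relation_index x' y' = k"
    using ex_relation_index_eq jk by (metis atMost_iff)
  have "E i $ x $ y = E i $ x' $ y'" if "i \<le> n" for i
    using v jk that unfolding E_entry[OF that] xy dual_polynomials_def dual_eigenvalue_def
    by (metis atMost_iff)
  moreover have "adjacency_matrix (R j) \<in> bose_mesner n R"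
    using jk adjacency_entry unfolding bose_mesner_iff by (intro exI[of _ "\<lambda>l. of_bool (l = j)"]) simp
  then obtain q where "adjacency_matrix (R j) = (\<Sum>l\<le>n. q l *\<^sub>R E l)"
    using E_spans by blast
  ultimately have "adjacency_matrix (R j) $ x $ y = adjacency_matrix (R j) $ x' $ y'"
    by simp
  then show "j = k" using jk by (simp add: adjacency_entry xy split: if_splits)
qed

lemma dual_polynomial_entry:
  assumes "dual_polynomials n R E v" "i \<le> n"
  shows "poly (v i) (dual_eigenvalue n R E (relation_index x y)) = real CARD('a) * E i $ x $ y"
  using assms relation_index_le by (simp add: E_entry dual_polynomials_def dual_eigenvalue_def)

text \<open>
  The measure is the sum over all pairs of points, each placed at the dual eigenvalue of its relation.
  It turns products of values of \<open>v\<^sub>i\<close> and \<open>v\<^sub>j\<close> into inner products of \<open>E\<^sub>i\<close> and \<open>E\<^sub>j\<close>, and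
  \<open>x v\<^sub>i\<^sup>2\<close> into the Krein number \<open>q\<^sub>1\<^sub>,\<^sub>i\<^sup>i\<close>.
\<close>
lemma dual_polynomial_parity:
  assumes v: "dual_polynomials n R E v" and krein: "\<forall>i\<in>{1..n}. krein_number n E 1 i i = 0"
    and "i \<le> n"
  shows "pcompose (v i) [:0, -1:] = smult ((-1) ^ i) (v i)"
proof -
  let ?N = "real CARD('a)"
  define t where "t = (\<lambda>(x, y). dual_eigenvalue n R E (relation_index x y))"
  have t: "poly (v i) (t (x, y)) = ?N * E i $ x $ y" if "i \<le> n" for i x y
    using dual_polynomial_entry[OF v that] by (simp add: t_def)
  have prod: "(\<Sum>w\<in>UNIV. poly (v i) (t w) * poly (v j) (t w)) = ?N\<^sup>2 * (E i \<bullet> E j)"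
    if "i \<le> n" "j \<le> n" for i j
    unfolding inner_matrix_eq_sum sum_distrib_left
    by (intro sum.cong) (auto simp: t that power2_eq_square)
  show ?thesis
  proof (rule orthogonal_poly_parity[where W = UNIV and t = t and n = n])
    show "degree (v i) = i" if "i \<le> n" for i
      using v that by (simp add: dual_polynomials_def)
    show "(\<Sum>w\<in>UNIV. poly (v i) (t w) * poly (v j) (t w)) = 0"
      if "i \<le> n" "j \<le> n" "i \<noteq> j" for i j
      using that by (simp add: prod inner_E)
    show "(\<Sum>w\<in>UNIV. (poly (v i) (t w))\<^sup>2) \<noteq> 0" if "i \<le> n" for i
      using prod[OF that that] E_nonzero[OF that] by (simp add: power2_eq_square)
    show "(\<Sum>w\<in>UNIV. t w * (poly (v i) (t w))\<^sup>2) = 0" if "i < n" for i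
    proof -
      have "1 \<le> n" "i \<le> n" using that by auto
      have E1: "E 1 $ x $ y = t (x, y) / ?N" for x y
        using E_entry[OF \<open>1 \<le> n\<close>] by (simp add: t_def dual_eigenvalue_def)
      have Ei: "E i $ x $ y = poly (v i) (t (x, y)) / ?N" for x y
        using t[OF \<open>i \<le> n\<close>] by simp
      show ?thesis
      \<comment> \<open>For \<open>i = 0\<close> orthogonality takes the place of the Krein number: \<open>E\<^sub>0\<close> is constant and the sum is a
        multiple of the inner product of \<open>E\<^sub>1\<close> and \<open>E\<^sub>0\<close>.\<close>
      proof (cases "i = 0")
        case True
        have "poly (v 0) (t (x, y)) = 1" for x y
          using t[of 0 x y] by (simp add: E_0 all_ones_def)
        then have "(\<Sum>w\<in>UNIV. t w * (poly (v i) (t w))\<^sup>2) = ?N\<^sup>2 * (E 1 \<bullet> E 0)"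
          unfolding inner_matrix_eq_sum sum_distrib_left
          by (intro sum.cong)
             (auto simp: True E1 E_0 all_ones_def power2_eq_square simp del: One_nat_def)
        then show ?thesis using \<open>1 \<le> n\<close> by (simp add: inner_E)
      next
        case False
        have "(\<Sum>w\<in>UNIV. t w * (poly (v i) (t w))\<^sup>2) = ?N ^ 3 * ((E 1 * E i) \<bullet> E i)"
          unfolding inner_matrix_eq_sum sum_distrib_left
          by (intro sum.cong)
             (auto simp: E1 Ei power2_eq_square power3_eq_cube simp del: One_nat_def)
        then show ?thesis
          using krein False \<open>1 \<le> n\<close> \<open>i \<le> n\<close> by (simp add: krein_as_inner)
      qed
    qed
  qed (fact \<open>i \<le> n\<close>)
qed

end

section \<open>The bound for codes\<close>

theorem theorem1p3:
  fixes n s :: nat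
    and R :: "nat \<Rightarrow> ('a::finite \<times> 'a) set"
    and E :: "nat \<Rightarrow> real^'a^'a"
    and v :: "nat \<Rightarrow> real poly"
    and C :: "'a set"
  assumes bipartite: "Q_bipartite n R E"
    and indexing: "\<forall>i\<le>n. dual_eigenvalue n R E (n - i) = - dual_eigenvalue n R E i"
    and polys: "dual_polynomials n R E v"
    and nonempty: "C \<noteq> {}"
    and sym: "symmetric_inner_distribution n R C"
    and deg: "s = code_degree n R C"
  shows "card C \<le> (\<Sum>i | i \<le> s \<and> [i = s] (mod 2). scheme_multiplicity E i) \<and>
    (card C = (\<Sum>i | i \<le> s \<and> [i = s] (mod 2). scheme_multiplicity E i) \<longrightarrow>
      (\<exists>S \<subseteq> {1..n - 1}. card S = s \<and> inj_on (dual_eigenvalue n R E) S \<and>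
        {z::complex. poly (map_poly complex_of_real (Psi_dual v s)) z = 0} =
          (\<lambda>i. complex_of_real (dual_eigenvalue n R E i)) ` S \<and>
        (\<forall>i\<in>S. order (dual_eigenvalue n R E i) (Psi_dual v s) = 1)))"
proof -
  interpret ordered_association_scheme n R E
    using bipartite unfolding Q_bipartite_def Q_polynomial_def by unfold_locales auto
  let ?N = "real CARD('a)" and ?\<theta> = "dual_eigenvalue n R E"
  define S where "S = degree_set n R C"
  define I where "I = {i. i \<le> s \<and> [i = s] (mod 2)}"
  define F where "F = (\<Prod>i\<in>S. [:- ?\<theta> i, 1:])"
  define F0 where "F0 = poly F (?\<theta> 0)"
  have S_n: "S \<subseteq> {1..n}" and s: "s = card S"
    by (auto simp: S_def degree_set_def deg code_degree_def)
  have S_fin: "finite S" using S_n finite_subset by blast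
  have S_refl: "n - i \<in> S" if "i \<in> S" for i
    using sym that by (simp add: symmetric_inner_distribution_def S_def)
  have "n \<notin> S" using S_refl[of n] S_n by auto
  then have S_n1: "S \<subseteq> {1..n - 1}" using S_n by (force simp: le_less)
  have sn: "s \<le> n" using card_mono[OF _ S_n] s by simp
  have I: "finite I" and I_n: "\<And>i. i \<in> I \<Longrightarrow> i \<le> n" using sn by (auto simp: I_def)
  have inj: "inj_on ?\<theta> {..n}" by (rule dual_eigenvalue_inj[OF polys])
  then have inj_S: "inj_on ?\<theta> S" by (rule inj_on_subset) (use S_n in auto)
  have F_root: "poly F x = 0 \<longleftrightarrow> x \<in> ?\<theta> ` S" for x
    using S_fin by (auto simp: F_def poly_prod)
  have "?\<theta> 0 \<noteq> ?\<theta> i" if "i \<in> S" for i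
    using inj that S_n by (force simp: inj_on_def)
  then have F0: "F0 \<noteq> 0" unfolding F0_def F_root by auto
  have "v 0 \<noteq> 0"
    using dual_polynomial_entry[OF polys, of 0] by (auto simp: E_0 all_ones_def)
  moreover have "degree F = s"
    unfolding F_def s by (subst degree_prod_eq_sum_degree) auto
  moreover have "pcompose F [:0, -1:] = smult ((-1) ^ s) F"
    unfolding F_def s using S_n S_refl indexing by (intro annihilator_parity[of _ n]) auto
  moreover have "degree (v i) = i" if "i \<le> s" for i
    using polys that sn by (simp add: dual_polynomials_def)
  moreover have "pcompose (v i) [:0, -1:] = smult ((-1) ^ i) (v i)" if "i \<le> s" for i
    using bipartite that sn by (intro dual_polynomial_parity[OF polys]) (auto simp: Q_bipartite_def)
  ultimately have "\<exists>c. F = (\<Sum>k | k \<le> s \<and> [k = s] (mod 2). smult (c k) (v k))"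
    by (intro parity_expansion) simp_all
  then obtain c where c: "F = (\<Sum>k\<in>I. smult (c k) (v k))" unfolding I_def ..
  define T where "T = (\<Sum>k\<in>I. (?N * c k / F0) *\<^sub>R E k)"
  have T_entry: "T $ x $ y = poly F (?\<theta> (relation_index x y)) / F0" for x y
    unfolding T_def c poly_sum sum_divide_distrib
    using I_n by (auto simp: dual_polynomial_entry[OF polys] intro!: sum.cong)
  have T_C: "T $ x $ y = of_bool (x = y)" if "x \<in> C" "y \<in> C" for x y
  proof (cases "x = y")
    case True
    then have index0: "relation_index x y = 0" by (simp add: relation_index_eq_0_iff)
    have "T $ x $ y = 1" unfolding T_entry index0 F0_def[symmetric] using F0 by simp
    then show ?thesis by (simp add: True)
  next
    case False
    then have "relation_index x y \<in> S"
      using that relation_index_eq_0_iff[of x y] relation_index_le[of x y]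
      by (auto simp: S_def mem_degree_set_iff Suc_le_eq)
    then have "poly F (?\<theta> (relation_index x y)) = 0" by (auto simp: F_root)
    then show ?thesis using False by (simp add: T_entry)
  qed
  have bound: "card C \<le> (\<Sum>i\<in>I. rank (E i))"
    by (rule card_le_sum_rank[OF I T_def]) (rule T_C)
  have "\<exists>S \<subseteq> {1..n - 1}. card S = s \<and> inj_on ?\<theta> S \<and>
        {z::complex. poly (map_poly complex_of_real (Psi_dual v s)) z = 0} =
          (\<lambda>i. complex_of_real (?\<theta> i)) ` S \<and>
        (\<forall>i\<in>S. order (?\<theta> i) (Psi_dual v s) = 1)"
    if tight: "card C = (\<Sum>i\<in>I. rank (E i))"
  proof -
    have C: "real (card C) \<noteq> 0" using nonempty by simp
    have "c k = F0 / real (card C)" if "k \<in> I" for k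
    proof -
      obtain d where "d \<noteq> 0" "\<And>x. E k $ x $ x = d"
        using E_diagonal I_n \<open>k \<in> I\<close> by blast
      then have "?N * c k / F0 * real (card C) = ?N"
        by (intro coefficient_if_tight[OF I T_def T_C tight E_mult])
           (use I_n that in auto)
      then show ?thesis using C F0 by (simp add: field_simps)
    qed
    then have "F = smult (F0 / real (card C)) (Psi_dual v s)"
      unfolding c Psi_dual_def I_def[symmetric] smult_sum_right by simp
    then have Psi: "Psi_dual v s = smult (real (card C) / F0) F"
      using C F0 by simp
    have "poly (map_poly complex_of_real (Psi_dual v s)) z = 0 \<longleftrightarrow>
        z \<in> (\<lambda>i. complex_of_real (?\<theta> i)) ` S" for z
      unfolding Psi using C F0 S_fin
      by (auto simp: map_poly_smult F_def poly_map_poly_prod_linear)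
    moreover have "order (?\<theta> i) (Psi_dual v s) = 1" if "i \<in> S" for i
      unfolding Psi using C F0 order_prod_linear[OF S_fin inj_S that]
      by (simp add: order_smult F_def)
    ultimately show ?thesis using S_n1 s inj_S by blast
  qed
  then show ?thesis
    using bound unfolding I_def scheme_multiplicity_def by blast
qed

end
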